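(* Let $(P,\succeq)$ be a finite poset. Then, for any integer $\ell\ge 1$, $$(H_P^\ell)^\wp=H_{P(\ell)},$$ where $H_P$ and $H_{P(\ell)}$ are Hibi ideals, $(P(\ell),\succeq_\ell)$ is the poset associated with $(P,\succeq)$ and $\ell$, and $\wp$ denotes the (relabelled) polarization.
   Context: Let $K$ be a field and $P=\{x_1,\dots,x_n\}$ a finite poset, whose elements are identified with variables. A poset ideal of $P$ is a subset $\mathcal I\subseteq P$ such that $q\in\mathcal I$, $p\in P$, $p\preceq q$ imply $p\in\mathcal I$. The Hibi ideal of $P$ is the ideal $H_P$ of $K[x_1,\dots,x_n,y_1,\dots,y_n]$ generated by the monomials $u_{\mathcal I}=\big(\prod_{x_i\in\mathcal I}x_i\big)\big(\prod_{x_i\in P\setminus\mathcal I}y_i\big)$, $\mathcal I$ a poset ideal of $P$. For $\ell\ge1$, $P(\ell)=\{x_{i,r}: i=1,\dots,n,\ r=1,\dots,\ell\}$, with $x_{i,r}\succeq_\ell x_{j,s}$ if and only if $x_i\succeq x_j$ and $r\ge s$. Its Hibi ideal $H_{P(\ell)}$ lives in $R=K[x_{i,j},y_{i,j}: i=1,\dots,n,\ j=1,\dots,\ell]$ and is generated by $u_{\mathcal I}=\big(\prod_{x_{i,j}\in\mathcal I}x_{i,j}\big)\big(\prod_{x_{i,j}\in P(\ell)\setminus\mathcal I}y_{i,j}\big)$, $\mathcal I$ a poset ideal of $P(\ell)$. Relabelled polarization: for $1\le k\le\ell$ put $(x_i^k)^\wp=x_{i,1}x_{i,2}\cdots x_{i,k}$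 and $(y_i^k)^\wp=y_{i,\ell}y_{i,\ell-1}\cdots y_{i,\ell+1-k}$, and for a monomial $u=\prod_i x_i^{a_i}y_i^{b_i}$ with all $a_i,b_i\le\ell$ put $u^\wp=\prod_{i:\,a_i>0}(x_i^{a_i})^\wp\prod_{i:\,b_i>0}(y_i^{b_i})^\wp\in R$. For a monomial ideal $I$ whose minimal monomial generators have all exponents $\le\ell$, $I^\wp\subset R$ is the ideal generated by $u^\wp$, $u$ ranging over the minimal monomial generators of $I$. (This is usual polarization up to the relabelling $y_{i,j}\mapsto y_{i,\ell+1-j}$.) *)

theory Defs
  imports "HOL-Algebra.Ideal_Product" "HOL-Library.Poly_Mapping"
begin

section \<open>Polynomial rings\<close>

text \<open>
  A monomial is its exponent vector, of type \<open>'v \<Rightarrow>\<^sub>0 nat\<close>; multiplication of monomials is addition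
  of exponent vectors, and the ring structure on \<open>('v \<Rightarrow>\<^sub>0 nat) \<Rightarrow>\<^sub>0 'k\<close> provided by
  \<^theory>\<open>HOL-Library.Poly_Mapping\<close> is that of polynomials over \<open>'k\<close> in variables of type \<open>'v\<close>.
\<close>

type_synonym ('v, 'k) mpoly = "('v \<Rightarrow>\<^sub>0 nat) \<Rightarrow>\<^sub>0 'k"

definition monom :: "('v \<Rightarrow>\<^sub>0 nat) \<Rightarrow> ('v, 'k::field) mpoly"
  where "monom u = Poly_Mapping.single u 1"

definition var :: "'v \<Rightarrow> ('v, 'k::field) mpoly"
  where "var v = monom (Poly_Mapping.single v 1)"

text \<open>The ring \<open>K[V]\<close>; \<open>K\<close> is the type \<open>'k\<close>, and \<open>V\<close> is an explicit set of variables.\<close>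

definition mpoly_ring :: "'v set \<Rightarrow> ('v, 'k::field) mpoly ring"
  where "mpoly_ring V =
    \<lparr>carrier = {f. \<forall>u\<in>Poly_Mapping.keys f. Poly_Mapping.keys u \<subseteq> V},
     mult = (*), one = 1, zero = 0, add = (+)\<rparr>"

text \<open>
  The order on exponent vectors is spelled out pointwise: \<open>u \<le> v\<close> in
  \<^theory>\<open>HOL-Library.Poly_Mapping\<close> is a lexicographic order, not divisibility.
\<close>

definition mon_dvd :: "('v \<Rightarrow>\<^sub>0 nat) \<Rightarrow> ('v \<Rightarrow>\<^sub>0 nat) \<Rightarrow> bool"
  where "mon_dvd u v \<longleftrightarrow>
    (\<forall>x. Poly_Mapping.lookup u x \<le> Poly_Mapping.lookup v x)"

text \<open>
  The set \<open>G(I)\<close> of minimal monomial generators of a monomial ideal \<open>I\<close>: the monomials of \<open>I\<close> that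
  are minimal with respect to divisibility. Lemmas \<open>genideal_min_gens\<close> and \<open>min_gens_subset\<close> below
  show that it generates \<open>I\<close> and is contained in every set of monomials generating \<open>I\<close>.
\<close>

definition min_gens :: "('v, 'k::field) mpoly set \<Rightarrow> ('v \<Rightarrow>\<^sub>0 nat) set"
  where "min_gens I =
    {u. (monom u :: ('v, 'k) mpoly) \<in> I \<and>
        (\<forall>v. (monom v :: ('v, 'k) mpoly) \<in> I \<longrightarrow> mon_dvd v u \<longrightarrow> v = u)}"


section \<open>Hibi ideals\<close>

text \<open>
  A poset is a set \<open>P\<close> with a relation \<open>r\<close> such that \<^term>\<open>partial_order_on P r\<close>;
  \<open>(p, q) \<in> r\<close> means \<open>p \<preceq> q\<close>.
\<close>

definition poset_ideals :: "'p set \<Rightarrow> ('p \<times> 'p) set \<Rightarrow> 'p set set"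
  where "poset_ideals P r =
    {I. I \<subseteq> P \<and> (\<forall>q\<in>I. \<forall>p\<in>P. (p, q) \<in> r \<longrightarrow> p \<in> I)}"

datatype 'p hvar = VarX 'p | VarY 'p

definition hibi_vars :: "'p set \<Rightarrow> 'p hvar set"
  where "hibi_vars P = VarX ` P \<union> VarY ` P"

definition hibi_ring :: "'p set \<Rightarrow> ('p hvar, 'k::field) mpoly ring"
  where "hibi_ring P = mpoly_ring (hibi_vars P)"

definition hibi_gen :: "'p set \<Rightarrow> 'p set \<Rightarrow> ('p hvar, 'k::field) mpoly"
  where "hibi_gen P I = (\<Prod>p\<in>I. var (VarX p)) * (\<Prod>p\<in>P - I. var (VarY p))"

definition hibi_ideal :: "'p set \<Rightarrow> ('p \<times> 'p) set \<Rightarrow> ('p hvar, 'k::field) mpoly set"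
  where "hibi_ideal P r = Idl\<^bsub>hibi_ring P\<^esub> (hibi_gen P ` poset_ideals P r)"

text \<open>The poset \<open>P(\<ell>)\<close>; the pair \<open>(p, a)\<close> stands for \<open>p\<^sub>a\<close>, i.e. \<open>x\<^sub>i\<^sub>,\<^sub>a\<close> if \<open>p = x\<^sub>i\<close>.\<close>

definition layer_set :: "'p set \<Rightarrow> nat \<Rightarrow> ('p \<times> nat) set"
  where "layer_set P l = P \<times> {1..l}"

definition layer_order ::
    "('p \<times> 'p) set \<Rightarrow> nat \<Rightarrow> (('p \<times> nat) \<times> ('p \<times> nat)) set"
  where "layer_order r l =
    {((p, a), (q, b)). (p, q) \<in> r \<and> a \<le> b \<and> a \<in> {1..l} \<and> b \<in> {1..l}}"


section \<open>Polarization\<close>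

text \<open>
  Only meaningful if all exponents of \<open>u\<close> are at most \<open>l\<close>; then the subtraction does not truncate.
\<close>

definition polarize_monom ::
    "nat \<Rightarrow> ('p hvar \<Rightarrow>\<^sub>0 nat) \<Rightarrow> (('p \<times> nat) hvar, 'k::field) mpoly"
  where "polarize_monom l u =
    (\<Prod>p | Poly_Mapping.lookup u (VarX p) > 0.
       \<Prod>j = 1..Poly_Mapping.lookup u (VarX p). var (VarX (p, j))) *
    (\<Prod>p | Poly_Mapping.lookup u (VarY p) > 0.
       \<Prod>j = 1..Poly_Mapping.lookup u (VarY p). var (VarY (p, l + 1 - j)))"

definition polarize_ideal ::
    "'p set \<Rightarrow> nat \<Rightarrow> ('p hvar, 'k::field) mpoly set \<Rightarrow> (('p \<times> nat) hvar, 'k) mpoly set"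
  where "polarize_ideal P l I =
    Idl\<^bsub>hibi_ring (layer_set P l)\<^esub> (polarize_monom l ` min_gens I)"


section \<open>Well-definedness\<close>

lemma carrier_mpoly_ring:
  "f \<in> carrier (mpoly_ring V) \<longleftrightarrow>
    (\<forall>u\<in>Poly_Mapping.keys f. Poly_Mapping.keys u \<subseteq> V)"
  by (simp add: mpoly_ring_def)

lemma mpoly_ring_simps [simp]:
  "mult (mpoly_ring V) = (*)" "one (mpoly_ring V) = 1"
  "zero (mpoly_ring V) = 0" "add (mpoly_ring V) = (+)"
  by (simp_all add: mpoly_ring_def)

lemma keys_multE:
  assumes "u \<in> Poly_Mapping.keys (f * g :: ('v, 'k::field) mpoly)"
  obtains a b where "u = a + b" "a \<in> Poly_Mapping.keys f" "b \<in> Poly_Mapping.keys g"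
  using assms keys_mult[of f g] by blast

lemma keys_addE:
  assumes "u \<in> Poly_Mapping.keys (f + g :: ('v, 'k::field) mpoly)"
  obtains "u \<in> Poly_Mapping.keys f" | "u \<in> Poly_Mapping.keys g"
  using assms Poly_Mapping.keys_add[of f g] by blast

lemma keys_exp_add:
  "Poly_Mapping.keys (a + b) = Poly_Mapping.keys a \<union> Poly_Mapping.keys (b :: 'v \<Rightarrow>\<^sub>0 nat)"
  by (auto simp: in_keys_iff lookup_add)

lemma keys_neg: "Poly_Mapping.keys (- f) = Poly_Mapping.keys (f :: ('v, 'k::field) mpoly)"
  by (auto simp: in_keys_iff)

lemma keys_monom [simp]: "Poly_Mapping.keys (monom u :: ('v, 'k::field) mpoly) = {u}"
  by (simp add: monom_def)

lemma monom_add: "monom (u + v) = monom u * (monom v :: ('v, 'k::field) mpoly)"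
  by (simp add: monom_def mult_single)

lemma cring_mpoly_ring: "cring (mpoly_ring V :: ('v, 'k::field) mpoly ring)"
proof (rule cringI)
  show "abelian_group (mpoly_ring V :: ('v, 'k) mpoly ring)"
  proof (rule abelian_groupI)
    fix f :: "('v, 'k) mpoly" assume "f \<in> carrier (mpoly_ring V)"
    then show "\<exists>g\<in>carrier (mpoly_ring V). g \<oplus>\<^bsub>mpoly_ring V\<^esub> f = \<zero>\<^bsub>mpoly_ring V\<^esub>"
      by (intro bexI[of _ "- f"]) (auto simp: carrier_mpoly_ring keys_neg)
  qed (auto simp: carrier_mpoly_ring algebra_simps elim!: keys_addE)
  show "comm_monoid (mpoly_ring V :: ('v, 'k) mpoly ring)"
    by (rule comm_monoidI)
       (auto simp: carrier_mpoly_ring algebra_simps keys_exp_add elim!: keys_multE, blast+)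
qed (auto simp: algebra_simps)

lemma mon_dvdE:
  assumes "mon_dvd u v" obtains w where "v = w + u"
proof
  show "v = (v - u) + u"
    using assms by (intro poly_mapping_eqI) (simp add: mon_dvd_def lookup_add lookup_minus)
qed

lemma mon_dvd_refl: "mon_dvd u u"
  by (simp add: mon_dvd_def)

lemma mon_dvd_trans: "mon_dvd u v \<Longrightarrow> mon_dvd v w \<Longrightarrow> mon_dvd u w"
  unfolding mon_dvd_def using order_trans by blast

lemma genideal_monom:
  fixes S :: "('v \<Rightarrow>\<^sub>0 nat) set"
  assumes "\<And>u. u \<in> S \<Longrightarrow> Poly_Mapping.keys u \<subseteq> V"
  shows "Idl\<^bsub>mpoly_ring V\<^esub> (monom ` S :: ('v, 'k::field) mpoly set) =
    {f \<in> carrier (mpoly_ring V). \<forall>u\<in>Poly_Mapping.keys f. \<exists>s\<in>S. mon_dvd s u}"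
    (is "?I = ?J")
proof
  let ?R = "mpoly_ring V :: ('v, 'k) mpoly ring"
  interpret cring ?R by (rule cring_mpoly_ring)
  have S: "monom ` S \<subseteq> carrier ?R"
    using assms by (auto simp: carrier_mpoly_ring)
  have neg: "inv\<^bsub>add_monoid ?R\<^esub> f = - f" if "f \<in> carrier ?R" for f
  proof -
    have "- f \<in> carrier ?R" using that by (simp add: carrier_mpoly_ring keys_neg)
    then have "\<ominus>\<^bsub>?R\<^esub> f = - f" using that by (intro minus_equality) auto
    then show ?thesis by (simp add: a_inv_def)
  qed
  have dvd_add: "mon_dvd s (a + b)" if "mon_dvd s a \<or> mon_dvd s b" for s a b :: "'v \<Rightarrow>\<^sub>0 nat"
    using that by (auto simp: mon_dvd_def lookup_add intro: trans_le_add1 trans_le_add2)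
  have mul: "f * g \<in> ?J" if f: "f \<in> ?J" and g: "g \<in> carrier ?R" for f g
  proof -
    have "f * g \<in> carrier ?R" using m_closed[of f g] f g by simp
    moreover have "\<exists>s\<in>S. mon_dvd s u" if u: "u \<in> Poly_Mapping.keys (f * g)" for u
    proof -
      obtain a b where "u = a + b" "a \<in> Poly_Mapping.keys f" using u by (elim keys_multE)
      moreover from this obtain s where "s \<in> S" "mon_dvd s a" using f by blast
      ultimately show ?thesis using dvd_add by blast
    qed
    ultimately show ?thesis by simp
  qed
  have "ideal ?J ?R"
  proof (rule idealI)
    show "ring ?R" by (rule ring_axioms)
    show "subgroup ?J (add_monoid ?R)"
    proof
      show "inv\<^bsub>add_monoid ?R\<^esub> f \<in> ?J" if "f \<in> ?J" for f
        using that neg[of f] by (simp add: keys_neg carrier_mpoly_ring)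
    qed (auto simp: carrier_mpoly_ring elim!: keys_addE)
  next
    fix f g assume "f \<in> ?J" "g \<in> carrier ?R"
    from mul[OF this] show "f \<otimes>\<^bsub>?R\<^esub> g \<in> ?J" "g \<otimes>\<^bsub>?R\<^esub> f \<in> ?J"
      by (simp_all add: mult.commute)
  qed
  moreover have "monom ` S \<subseteq> ?J"
    using S mon_dvd_refl by fastforce
  ultimately show "?I \<subseteq> ?J" by (rule genideal_minimal)
  interpret I: ideal ?I ?R by (rule genideal_ideal[OF S])
  show "?J \<subseteq> ?I"
  proof
    fix f :: "('v, 'k) mpoly" assume "f \<in> ?J"
    then have fc: "f \<in> carrier ?R" and fd: "\<forall>u\<in>Poly_Mapping.keys f. \<exists>s\<in>S. mon_dvd s u"
      by simp_all
    have tm: "Poly_Mapping.single u c \<in> ?I" if "u \<in> Poly_Mapping.keys f" for u and c :: 'k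
    proof -
      from bspec[OF fd that] obtain s where s: "s \<in> S" "mon_dvd s u" by (rule bexE)
      from s(2) obtain w where u: "u = w + s" by (rule mon_dvdE)
      have "Poly_Mapping.keys u \<subseteq> V"
        using fc that unfolding carrier_mpoly_ring by (rule bspec)
      then have "Poly_Mapping.keys w \<subseteq> V"
        unfolding u keys_exp_add by blast
      then have "Poly_Mapping.single w c \<in> carrier ?R"
        by (simp add: carrier_mpoly_ring)
      moreover have "monom s \<in> ?I" using genideal_self[OF S] s by blast
      ultimately have "Poly_Mapping.single w c \<otimes>\<^bsub>?R\<^esub> monom s \<in> ?I"
        by (intro I.I_l_closed)
      moreover have "Poly_Mapping.single w c \<otimes>\<^bsub>?R\<^esub> monom s = Poly_Mapping.single u c"
        by (simp add: monom_def mult_single u)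
      ultimately show ?thesis by (simp only:)
    qed
    have sub: "(\<Sum>u\<in>A. Poly_Mapping.single u (Poly_Mapping.lookup f u)) \<in> ?I"
      if "A \<subseteq> Poly_Mapping.keys f" for A
      using finite_subset[OF that finite_keys] that
    proof (induction A rule: finite_induct)
      case empty
      show ?case using I.zero_closed by simp
    next
      case (insert u A)
      let ?t = "\<lambda>u. Poly_Mapping.single u (Poly_Mapping.lookup f u)"
      have "?t u \<oplus>\<^bsub>?R\<^esub> sum ?t A \<in> ?I"
        using insert by (intro I.a_closed tm) blast+
      then show ?case
        by (simp only: mpoly_ring_simps sum.insert[OF insert.hyps])
    qed
    moreover have "(\<Sum>u\<in>Poly_Mapping.keys f. Poly_Mapping.single u (Poly_Mapping.lookup f u)) = f"
      by (rule poly_mapping_eqI)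
         (simp add: lookup_sum lookup_single when_def in_keys_iff)
    ultimately show "f \<in> ?I" using sub[OF order_refl] by (simp only:)
  qed
qed

lemma min_gens_dvd:
  fixes I :: "('v, 'k::field) mpoly set"
  assumes "(monom u :: ('v, 'k) mpoly) \<in> I"
  shows "\<exists>v\<in>min_gens I. mon_dvd v u"
proof -
  define deg where "deg v = (\<Sum>x\<in>Poly_Mapping.keys u. Poly_Mapping.lookup v x)"
    for v :: "'v \<Rightarrow>\<^sub>0 nat"
  define A where "A = {v. (monom v :: ('v, 'k) mpoly) \<in> I \<and> mon_dvd v u}"
  have "u \<in> A" using assms by (simp add: A_def mon_dvd_refl)
  then obtain v where v: "v \<in> A" and min: "\<And>w. w \<in> A \<Longrightarrow> deg v \<le> deg w"
    using ex_has_least_nat[of "\<lambda>v. v \<in> A" u deg] by blast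
  have "w = v" if "(monom w :: ('v, 'k) mpoly) \<in> I" and wv: "mon_dvd w v" for w
  proof (rule ccontr)
    assume "w \<noteq> v"
    have wA: "w \<in> A" using that v by (auto simp: A_def intro: mon_dvd_trans)
    obtain x where x: "Poly_Mapping.lookup w x < Poly_Mapping.lookup v x"
      using wv \<open>w \<noteq> v\<close> unfolding mon_dvd_def
      by (metis le_neq_implies_less poly_mapping_eqI)
    have "mon_dvd v u" using v by (simp add: A_def)
    then have "Poly_Mapping.lookup v x \<le> Poly_Mapping.lookup u x" by (simp add: mon_dvd_def)
    then have "x \<in> Poly_Mapping.keys u" using x by (simp add: in_keys_iff)
    then have "deg w < deg v"
      unfolding deg_def using wv x
      by (intro sum_strict_mono_ex1) (auto simp: mon_dvd_def)
    with min[OF wA] show False by simp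
  qed
  then have "v \<in> min_gens I" using v by (auto simp: min_gens_def A_def)
  then show ?thesis using v by (auto simp: A_def)
qed

lemma genideal_min_gens:
  fixes S :: "('v \<Rightarrow>\<^sub>0 nat) set" and I :: "('v, 'k::field) mpoly set"
  assumes "\<And>u. u \<in> S \<Longrightarrow> Poly_Mapping.keys u \<subseteq> V"
    and I: "I = Idl\<^bsub>mpoly_ring V\<^esub> (monom ` S)"
  shows "Idl\<^bsub>mpoly_ring V\<^esub> (monom ` min_gens I) = I"
proof -
  have I': "I = {f \<in> carrier (mpoly_ring V). \<forall>u\<in>Poly_Mapping.keys f. \<exists>s\<in>S. mon_dvd s u}"
    using genideal_monom[OF assms(1)] I by blast
  have G: "Poly_Mapping.keys u \<subseteq> V" if "u \<in> min_gens I" for u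
    using that I' by (auto simp: min_gens_def carrier_mpoly_ring)
  have SI: "(monom s :: ('v, 'k) mpoly) \<in> I" if "s \<in> S" for s
    using that assms(1) by (auto simp: I' carrier_mpoly_ring intro: mon_dvd_refl)
  have eq: "(\<exists>s\<in>S. mon_dvd s u) \<longleftrightarrow> (\<exists>s\<in>min_gens I. mon_dvd s u)" for u
  proof
    assume "\<exists>s\<in>S. mon_dvd s u"
    then show "\<exists>s\<in>min_gens I. mon_dvd s u"
      using SI min_gens_dvd mon_dvd_trans by blast
  next
    assume "\<exists>s\<in>min_gens I. mon_dvd s u"
    then obtain s where s: "(monom s :: ('v, 'k) mpoly) \<in> I" "mon_dvd s u"
      by (auto simp: min_gens_def)
    from s(1) have "\<exists>t\<in>S. mon_dvd t s" by (subst (asm) I') simp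
    with s(2) show "\<exists>s\<in>S. mon_dvd s u" using mon_dvd_trans by blast
  qed
  have "Idl\<^bsub>mpoly_ring V\<^esub> (monom ` min_gens I) =
      {f \<in> carrier (mpoly_ring V) :: ('v, 'k) mpoly set.
        \<forall>u\<in>Poly_Mapping.keys f. \<exists>s\<in>min_gens I. mon_dvd s u}"
    by (rule genideal_monom[OF G])
  also have "\<dots> = {f \<in> carrier (mpoly_ring V). \<forall>u\<in>Poly_Mapping.keys f. \<exists>s\<in>S. mon_dvd s u}"
    by (simp only: eq)
  also have "\<dots> = I" by (rule I'[symmetric])
  finally show ?thesis .
qed

lemma min_gens_subset:
  fixes S :: "('v \<Rightarrow>\<^sub>0 nat) set" and I :: "('v, 'k::field) mpoly set"
  assumes "\<And>u. u \<in> S \<Longrightarrow> Poly_Mapping.keys u \<subseteq> V"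
    and I: "I = Idl\<^bsub>mpoly_ring V\<^esub> (monom ` S)"
  shows "min_gens I \<subseteq> S"
proof
  have I': "I = {f \<in> carrier (mpoly_ring V). \<forall>u\<in>Poly_Mapping.keys f. \<exists>s\<in>S. mon_dvd s u}"
    using genideal_monom[OF assms(1)] I by blast
  fix u assume u: "u \<in> min_gens I"
  then have "(monom u :: ('v, 'k) mpoly) \<in> I" by (simp add: min_gens_def)
  then obtain s where s: "s \<in> S" "mon_dvd s u" by (subst (asm) I') auto
  have "(monom s :: ('v, 'k) mpoly) \<in> I"
    using s assms(1) by (auto simp: I' carrier_mpoly_ring intro: mon_dvd_refl)
  with u s show "u \<in> S" by (auto simp: min_gens_def)
qed

text \<open>The Hibi ideal is a monomial ideal with squarefree generators.\<close>

definition hibi_exp :: "'p set \<Rightarrow> 'p set \<Rightarrow> ('p hvar \<Rightarrow>\<^sub>0 nat)"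
  where "hibi_exp P I = (\<Sum>p\<in>I. Poly_Mapping.single (VarX p) 1) +
    (\<Sum>p\<in>P - I. Poly_Mapping.single (VarY p) 1)"

lemma prod_var: "(\<Prod>p\<in>A. var (h p)) =
    (monom (\<Sum>p\<in>A. Poly_Mapping.single (h p) 1) :: ('v, 'k::field) mpoly)"
proof (induction A rule: infinite_finite_induct)
  case (insert p A)
  then show ?case by (simp only: prod.insert sum.insert monom_add var_def not_False_eq_True)
qed (simp_all add: monom_def)

lemma hibi_gen_monom: "hibi_gen P I = (monom (hibi_exp P I) :: ('p hvar, 'k::field) mpoly)"
  by (simp only: hibi_gen_def hibi_exp_def prod_var monom_add)

lemma lookup_hibi_exp:
  assumes "finite P" "I \<subseteq> P"
  shows "Poly_Mapping.lookup (hibi_exp P I) (VarX p) = (if p \<in> I then 1 else 0)"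
    and "Poly_Mapping.lookup (hibi_exp P I) (VarY p) = (if p \<in> P - I then 1 else 0)"
  using assms finite_subset[OF assms(2,1)]
  by (simp_all add: hibi_exp_def lookup_add lookup_sum lookup_single when_def)

lemma keys_hibi_exp:
  assumes "finite P" "I \<subseteq> P"
  shows "Poly_Mapping.keys (hibi_exp P I) \<subseteq> hibi_vars P"
proof
  fix x assume "x \<in> Poly_Mapping.keys (hibi_exp P I)"
  then show "x \<in> hibi_vars P"
    using assms by (cases x) (auto simp: in_keys_iff lookup_hibi_exp hibi_vars_def split: if_splits)
qed

lemma hibi_ideal_iff:
  fixes f :: "('p hvar, 'k::field) mpoly"
  assumes "finite P"
  shows "f \<in> hibi_ideal P r \<longleftrightarrow> f \<in> carrier (hibi_ring P) \<and>
    (\<forall>u\<in>Poly_Mapping.keys f. \<exists>I\<in>poset_ideals P r. mon_dvd (hibi_exp P I) u)"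
proof -
  have "hibi_ideal P r = Idl\<^bsub>mpoly_ring (hibi_vars P)\<^esub>
      (monom ` hibi_exp P ` poset_ideals P r :: ('p hvar, 'k) mpoly set)"
    by (simp add: hibi_ideal_def hibi_ring_def hibi_gen_monom image_image)
  also have "\<dots> = {f \<in> carrier (mpoly_ring (hibi_vars P)). \<forall>u\<in>Poly_Mapping.keys f.
      \<exists>s\<in>hibi_exp P ` poset_ideals P r. mon_dvd s u}"
    using assms keys_hibi_exp[of P] by (intro genideal_monom) (auto simp: poset_ideals_def)
  finally show ?thesis by (auto simp: hibi_ring_def)
qed

text \<open>
  Hence the polarization of the \<open>l\<close>-th power is only ever applied to monomials with exponents at
  most \<open>l\<close>.
\<close>

lemma hibi_power_dvd:
  fixes f :: "('p hvar, 'k::field) mpoly"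
  assumes "finite P"
    and "f \<in> hibi_ideal P r [^]\<^bsub>ideals_set (hibi_ring P)\<^esub> l"
    and "u \<in> Poly_Mapping.keys f"
  shows "\<exists>v. mon_dvd v u \<and> (\<forall>x. Poly_Mapping.lookup v x \<le> l) \<and>
    (monom v :: ('p hvar, 'k) mpoly) \<in> hibi_ideal P r [^]\<^bsub>ideals_set (hibi_ring P)\<^esub> l"
  using assms(2,3)
proof (induction l arbitrary: f u)
  case 0
  have "mon_dvd 0 u" by (simp add: mon_dvd_def)
  moreover have "(monom 0 :: ('p hvar, 'k) mpoly) \<in> carrier (hibi_ring P)"
    by (simp add: hibi_ring_def carrier_mpoly_ring)
  ultimately show ?case
    by (intro exI[of _ 0]) (simp add: ideals_set_def nat_pow_def)
next
  case (Suc l)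
  let ?R = "hibi_ring P :: ('p hvar, 'k) mpoly ring"
  let ?H = "hibi_ideal P r :: ('p hvar, 'k) mpoly set"
  let ?Hl = "?H [^]\<^bsub>ideals_set ?R\<^esub> l"
  have pow: "?H [^]\<^bsub>ideals_set ?R\<^esub> Suc l = ideal_prod ?R ?Hl ?H"
    by (simp add: nat_pow_def ideals_set_def)
  have "f \<in> ideal_prod ?R ?Hl ?H" using Suc.prems pow by simp
  then have "\<forall>u\<in>Poly_Mapping.keys f. \<exists>v. mon_dvd v u \<and> (\<forall>x. Poly_Mapping.lookup v x \<le> Suc l) \<and>
    (monom v :: ('p hvar, 'k) mpoly) \<in> ideal_prod ?R ?Hl ?H"
  proof induction
    case (prod i j)
    show ?case
    proof
      fix u assume "u \<in> Poly_Mapping.keys (i \<otimes>\<^bsub>?R\<^esub> j)"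
      then obtain a b where u: "u = a + b" and a: "a \<in> Poly_Mapping.keys i"
        and b: "b \<in> Poly_Mapping.keys j"
        by (auto simp: hibi_ring_def elim: keys_multE)
      obtain v where v: "mon_dvd v a" "\<forall>x. Poly_Mapping.lookup v x \<le> l"
        "(monom v :: ('p hvar, 'k) mpoly) \<in> ?Hl"
        using Suc.IH[OF prod(1) a] by blast
      obtain J where J: "J \<in> poset_ideals P r" "mon_dvd (hibi_exp P J) b"
        using prod(2) b hibi_ideal_iff[OF \<open>finite P\<close>] by blast
      have JP: "J \<subseteq> P" using J by (simp add: poset_ideals_def)
      have le1: "Poly_Mapping.lookup (hibi_exp P J) x \<le> 1" for x
        using lookup_hibi_exp[OF \<open>finite P\<close> JP] by (cases x) auto
      have mem: "(monom (hibi_exp P J) :: ('p hvar, 'k) mpoly) \<in> ?H"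
        using J(1) keys_hibi_exp[OF \<open>finite P\<close> JP]
        by (auto simp: hibi_ideal_iff[OF \<open>finite P\<close>] hibi_ring_def carrier_mpoly_ring
              intro: mon_dvd_refl)
      have "(monom (v + hibi_exp P J) :: ('p hvar, 'k) mpoly) \<in> ideal_prod ?R ?Hl ?H"
        using ideal_prod.prod[OF v(3) mem, of ?R] by (simp add: hibi_ring_def monom_add)
      moreover have "mon_dvd (v + hibi_exp P J) u"
        using v(1) J(2) by (auto simp: u mon_dvd_def lookup_add intro: add_mono)
      moreover have "\<forall>x. Poly_Mapping.lookup (v + hibi_exp P J) x \<le> Suc l"
      proof
        fix x
        have "Poly_Mapping.lookup v x \<le> l" using v(2) by blast
        then show "Poly_Mapping.lookup (v + hibi_exp P J) x \<le> Suc l"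
          using le1[of x] by (simp add: lookup_add)
      qed
      ultimately show "\<exists>v. mon_dvd v u \<and> (\<forall>x. Poly_Mapping.lookup v x \<le> Suc l) \<and>
          (monom v :: ('p hvar, 'k) mpoly) \<in> ideal_prod ?R ?Hl ?H" by blast
    qed
  next
    case (sum s1 s2)
    then show ?case by (auto simp: hibi_ring_def elim!: keys_addE)
  qed
  then show ?case using Suc.prems(2) pow by simp
qed

lemma min_gens_hibi_power_le:
  fixes P :: "'p set"
  assumes "finite P"
    and "u \<in> min_gens (hibi_ideal P r [^]\<^bsub>ideals_set (hibi_ring P)\<^esub> l
                          :: ('p hvar, 'k::field) mpoly set)"
  shows "Poly_Mapping.lookup u x \<le> l"
proof -
  have u: "(monom u :: ('p hvar, 'k) mpoly) \<in> hibi_ideal P r [^]\<^bsub>ideals_set (hibi_ring P)\<^esub> l"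
    using assms(2) by (simp add: min_gens_def)
  obtain v where v: "mon_dvd v u" "\<forall>x. Poly_Mapping.lookup v x \<le> l"
    "(monom v :: ('p hvar, 'k) mpoly) \<in> hibi_ideal P r [^]\<^bsub>ideals_set (hibi_ring P)\<^esub> l"
    using hibi_power_dvd[OF assms(1) u, of u] by auto
  then have "v = u" using assms(2) by (simp add: min_gens_def)
  then show ?thesis using v(2) by blast
qed

end

theory Submission
  imports Defs
begin

text \<open>
  A product \<open>u\<^bsub>I\<^sub>1\<^esub> \<cdots> u\<^bsub>I\<^sub>l\<^esub>\<close> of generators of \<open>H\<^sub>P\<close> depends only on the multiplicity function
  \<open>c(p) = #{k. p \<in> I\<^sub>k}\<close>: it is \<open>\<Prod>\<^sub>p x\<^sub>p\<^bsup>c(p)\<^esup> y\<^sub>p\<^bsup>l - c(p)\<^esup>\<close>. The functions \<open>c\<close> that occur are exactly the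
  antitone maps \<open>P \<rightarrow> {0..l}\<close>, and distinct ones give incomparable monomials, so these monomials
  are the minimal generators of \<open>H\<^sub>P\<^sup>l\<close>. The antitone maps also parametrize the poset ideals of
  \<open>P(l)\<close>, via \<open>c \<mapsto> {p\<^sub>a. a \<le> c(p)}\<close>, and polarizing the monomial of \<open>c\<close> gives the generator of
  \<open>H\<^bsub>P(l)\<^esub>\<close> belonging to this ideal.
\<close>

section \<open>Monomial ideals\<close>

lemma mon_dvd_antisym: "mon_dvd u v \<Longrightarrow> mon_dvd v u \<Longrightarrow> u = v"
  by (intro poly_mapping_eqI) (simp add: mon_dvd_def order_antisym)

lemma mon_dvd_add: "mon_dvd u u' \<Longrightarrow> mon_dvd v v' \<Longrightarrow> mon_dvd (u + v) (u' + v')"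
  by (simp add: mon_dvd_def lookup_add add_mono)

text \<open>A monomial \<open>v\<close> of \<open>I\<close> is a multiple of some \<open>t\<close>
  in \<open>S\<close>. If \<open>v\<close> also divides \<open>s\<close> in \<open>S\<close>, then
  \<open>t\<close> divides \<open>s\<close>, so \<open>t = s\<close> by the antichain property, and
  \<open>v\<close>, squeezed in between, equals \<open>s\<close>.\<close>

lemma min_gens_antichain:
  fixes S :: "('v \<Rightarrow>\<^sub>0 nat) set" and I :: "('v, 'k::field) mpoly set"
  assumes keys: "\<And>u. u \<in> S \<Longrightarrow> Poly_Mapping.keys u \<subseteq> V"
    and I: "I = Idl\<^bsub>mpoly_ring V\<^esub> (monom ` S)"
    and antichain: "\<And>u v. u \<in> S \<Longrightarrow> v \<in> S \<Longrightarrow> mon_dvd u v \<Longrightarrow> u = v"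
  shows "min_gens I = S"
proof
  show "min_gens I \<subseteq> S" by (rule min_gens_subset[OF keys I])
  show "S \<subseteq> min_gens I"
  proof
    fix s assume s: "s \<in> S"
    have I': "I = {f \<in> carrier (mpoly_ring V). \<forall>u\<in>Poly_Mapping.keys f. \<exists>s\<in>S. mon_dvd s u}"
      using genideal_monom[OF keys] I by blast
    have "(monom s :: ('v, 'k) mpoly) \<in> I"
      using s keys by (auto simp: I' carrier_mpoly_ring intro: mon_dvd_refl)
    moreover have "v = s" if v: "(monom v :: ('v, 'k) mpoly) \<in> I" "mon_dvd v s" for v
    proof -
      obtain t where t: "t \<in> S" "mon_dvd t v" using v(1) unfolding I' by auto
      then have "t = s" using antichain s v(2) mon_dvd_trans by blast
      then show ?thesis using t v(2) mon_dvd_antisym by blast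
    qed
    ultimately show "s \<in> min_gens I" by (simp add: min_gens_def)
  qed
qed

text \<open>For the inclusion from left to right, every monomial of \<open>f * g\<close> is a
  monomial of \<open>f\<close> times one of \<open>g\<close>, hence a multiple of some
  \<open>s + t\<close>, so the support criterion \<open>genideal_monom\<close> applies.\<close>

lemma ideal_prod_genideal_monom:
  fixes S T :: "('v \<Rightarrow>\<^sub>0 nat) set"
  assumes S: "\<And>u. u \<in> S \<Longrightarrow> Poly_Mapping.keys u \<subseteq> V"
    and T: "\<And>u. u \<in> T \<Longrightarrow> Poly_Mapping.keys u \<subseteq> V"
  defines "R \<equiv> mpoly_ring V :: ('v, 'k::field) mpoly ring"
  shows "ideal_prod R (Idl\<^bsub>R\<^esub> (monom ` S)) (Idl\<^bsub>R\<^esub> (monom ` T)) =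
    Idl\<^bsub>R\<^esub> (monom ` {s + t | s t. s \<in> S \<and> t \<in> T})"
    (is "ideal_prod R ?I ?J = Idl\<^bsub>R\<^esub> (monom ` ?ST)")
proof
  interpret cring R unfolding R_def by (rule cring_mpoly_ring)
  have ST: "Poly_Mapping.keys u \<subseteq> V" if u: "u \<in> ?ST" for u
  proof -
    obtain s t where "u = s + t" "s \<in> S" "t \<in> T" using u by blast
    then show ?thesis using S[of s] T[of t] by (simp add: keys_exp_add)
  qed
  have sub: "monom ` S \<subseteq> carrier R" "monom ` T \<subseteq> carrier R" "monom ` ?ST \<subseteq> carrier R"
    unfolding R_def by (intro subsetI, elim imageE, simp add: carrier_mpoly_ring S T ST)+
  have mems: "Idl\<^bsub>R\<^esub> (monom ` U) =
      {f \<in> carrier R. \<forall>u\<in>Poly_Mapping.keys f. \<exists>s\<in>U. mon_dvd s u}"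
    if "U \<in> {S, T, ?ST}" for U
    unfolding R_def by (rule genideal_monom) (use that S T ST in blast)
  interpret K: ideal "Idl\<^bsub>R\<^esub> (monom ` ?ST)" R by (rule genideal_ideal[OF sub(3)])
  have prod_mem: "f * g \<in> Idl\<^bsub>R\<^esub> (monom ` ?ST)" if f: "f \<in> ?I" and g: "g \<in> ?J" for f g
  proof -
    have "f * g \<in> carrier R"
      using m_closed[of f g] f g mems[of S] mems[of T] by (simp add: R_def)
    moreover have "\<exists>w\<in>?ST. mon_dvd w u" if key: "u \<in> Poly_Mapping.keys (f * g)" for u
    proof -
      obtain a b where u: "u = a + b" "a \<in> Poly_Mapping.keys f" "b \<in> Poly_Mapping.keys g"
        using key by (rule keys_multE)
      obtain s where "s \<in> S" "mon_dvd s a" using f u(2) mems[of S] by blast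
      moreover obtain t where "t \<in> T" "mon_dvd t b" using g u(3) mems[of T] by blast
      ultimately show ?thesis using mon_dvd_add u(1) by blast
    qed
    ultimately show ?thesis using mems[of ?ST] by blast
  qed
  show "ideal_prod R ?I ?J \<subseteq> Idl\<^bsub>R\<^esub> (monom ` ?ST)"
  proof
    fix f assume "f \<in> ideal_prod R ?I ?J"
    then show "f \<in> Idl\<^bsub>R\<^esub> (monom ` ?ST)"
    proof induction
      case (prod i j)
      then show ?case using prod_mem by (simp add: R_def)
    next
      case (sum s1 s2)
      then show ?case by (intro K.a_closed)
    qed
  qed
  have "ideal (ideal_prod R ?I ?J) R"
    by (intro ideal_prod_is_ideal genideal_ideal sub)
  moreover have "monom ` ?ST \<subseteq> ideal_prod R ?I ?J"
  proof
    fix f :: "('v, 'k) mpoly" assume "f \<in> monom ` ?ST"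
    then obtain s t where f: "s \<in> S" "t \<in> T" "f = monom s * monom t"
      by (auto simp: monom_add)
    then have "monom s \<in> ?I" "monom t \<in> ?J" using genideal_self sub by blast+
    from ideal_prod.prod[OF this, of R] show "f \<in> ideal_prod R ?I ?J"
      using f by (simp add: R_def)
  qed
  ultimately show "Idl\<^bsub>R\<^esub> (monom ` ?ST) \<subseteq> ideal_prod R ?I ?J"
    by (rule genideal_minimal)
qed

section \<open>Powers of the Hibi ideal\<close>

text \<open>Values outside \<open>P\<close> are left free; \<open>mult_exp\<close> and
  \<open>layer_ideal\<close> read \<open>c\<close> only on \<open>P\<close>.\<close>

definition antitone_maps :: "'p set \<Rightarrow> ('p \<times> 'p) set \<Rightarrow> nat \<Rightarrow> ('p \<Rightarrow> nat) set"
  where "antitone_maps P r l =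
    {c. (\<forall>p\<in>P. c p \<le> l) \<and> (\<forall>p\<in>P. \<forall>q\<in>P. (p, q) \<in> r \<longrightarrow> c q \<le> c p)}"

definition mult_exp :: "'p set \<Rightarrow> nat \<Rightarrow> ('p \<Rightarrow> nat) \<Rightarrow> ('p hvar \<Rightarrow>\<^sub>0 nat)"
  where "mult_exp P l c =
    (\<Sum>p\<in>P. Poly_Mapping.single (VarX p) (c p) + Poly_Mapping.single (VarY p) (l - c p))"

lemma lookup_mult_exp [simp]:
  assumes "finite P"
  shows "Poly_Mapping.lookup (mult_exp P l c) (VarX p) = (if p \<in> P then c p else 0)"
    and "Poly_Mapping.lookup (mult_exp P l c) (VarY p) = (if p \<in> P then l - c p else 0)"
  using assms by (simp_all add: mult_exp_def lookup_add lookup_sum lookup_single when_def)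

lemma keys_mult_exp:
  assumes "finite P"
  shows "Poly_Mapping.keys (mult_exp P l c) \<subseteq> hibi_vars P"
proof
  fix x assume "x \<in> Poly_Mapping.keys (mult_exp P l c)"
  then show "x \<in> hibi_vars P"
    using assms by (cases x) (auto simp: in_keys_iff hibi_vars_def split: if_splits)
qed

lemma hvar_poly_mapping_eqI:
  assumes "\<And>p. Poly_Mapping.lookup u (VarX p) = Poly_Mapping.lookup v (VarX p)"
    and "\<And>p. Poly_Mapping.lookup u (VarY p) = Poly_Mapping.lookup v (VarY p)"
  shows "u = v"
proof (rule poly_mapping_eqI)
  show "Poly_Mapping.lookup u x = Poly_Mapping.lookup v x" for x
    by (cases x) (simp_all add: assms)
qed

text \<open>The x-exponents give \<open>c p \<le> d p\<close>, and the y-exponents give the reverse,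
  since neither subtraction from \<open>l\<close> truncates. Only the monomials are claimed equal:
  the maps may differ off \<open>P\<close>.\<close>

lemma mult_exp_antichain:
  assumes "finite P" "c \<in> antitone_maps P r l" "d \<in> antitone_maps P r l"
    and dvd: "mon_dvd (mult_exp P l c) (mult_exp P l d)"
  shows "mult_exp P l c = mult_exp P l d"
proof -
  have "c p = d p" if "p \<in> P" for p
  proof -
    have "Poly_Mapping.lookup (mult_exp P l c) x \<le> Poly_Mapping.lookup (mult_exp P l d) x" for x
      using dvd by (simp add: mon_dvd_def)
    from this[of "VarX p"] this[of "VarY p"] have "c p \<le> d p" "l - c p \<le> l - d p"
      using that assms(1) by simp_all
    moreover have "c p \<le> l" "d p \<le> l"
      using that assms(2,3) by (simp_all add: antitone_maps_def)
    ultimately show ?thesis by simp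
  qed
  then show ?thesis by (simp add: mult_exp_def)
qed

text \<open>Multiplying by the generator of \<open>I\<close> adds the indicator of \<open>I\<close>
  to \<open>c\<close>. Conversely, one generator can be split off by lowering \<open>c\<close> by 1
  on its top level set.\<close>

lemma mult_exp_Suc:
  assumes "finite P"
  shows "{s + t | s t. s \<in> mult_exp P l ` antitone_maps P r l \<and> t \<in> hibi_exp P ` poset_ideals P r} =
    mult_exp P (Suc l) ` antitone_maps P r (Suc l)"
    (is "?A = ?B")
proof
  show "?A \<subseteq> ?B"
  proof
    fix u assume "u \<in> ?A"
    then obtain c I where c: "c \<in> antitone_maps P r l" and I: "I \<in> poset_ideals P r"
      and u: "u = mult_exp P l c + hibi_exp P I" by blast
    have IP: "I \<subseteq> P" using I by (simp add: poset_ideals_def)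
    have "u = mult_exp P (Suc l) (\<lambda>p. c p + of_bool (p \<in> I))"
      unfolding u using assms IP c
      by (intro hvar_poly_mapping_eqI)
         (auto simp: lookup_add lookup_hibi_exp antitone_maps_def Suc_diff_le)
    \<comment> \<open>The indicator of a down-closed set is antitone.\<close>
    moreover have "(\<lambda>p. c p + of_bool (p \<in> I)) \<in> antitone_maps P r (Suc l)"
      using c I by (auto simp: antitone_maps_def poset_ideals_def le_SucI)
    ultimately show "u \<in> ?B" by blast
  qed
  show "?B \<subseteq> ?A"
  proof
    fix u assume "u \<in> ?B"
    then obtain c where c: "c \<in> antitone_maps P r (Suc l)" and u: "u = mult_exp P (Suc l) c"
      by blast
    \<comment> \<open>Below a point of value \<open>Suc l\<close>, antitonicity and the bound force
      the value \<open>Suc l\<close> again, so \<open>I\<close> is a poset ideal; subtracting its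
      indicator from \<open>c\<close> leaves \<open>min (c p) l\<close> on \<open>P\<close>.\<close>
    define I where "I = {p \<in> P. c p = Suc l}"
    have I: "I \<in> poset_ideals P r"
      using c by (auto simp: I_def poset_ideals_def antitone_maps_def) (metis order_antisym)
    have "(\<lambda>p. min (c p) l) \<in> antitone_maps P r l"
      using c by (auto simp: antitone_maps_def min_le_iff_disj)
    moreover have "u = mult_exp P l (\<lambda>p. min (c p) l) + hibi_exp P I"
    proof -
      have "I \<subseteq> P" by (auto simp: I_def)
      moreover have "c p \<le> Suc l" if "p \<in> P" for p
        using c that by (simp add: antitone_maps_def)
      ultimately show ?thesis unfolding u using assms
        by (intro hvar_poly_mapping_eqI)
           (auto simp: lookup_add lookup_hibi_exp I_def min_def Suc_diff_le le_Suc_eq)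
    qed
    ultimately show "u \<in> ?A" using I by blast
  qed
qed

lemma hibi_power_genideal:
  fixes P :: "'p set"
  assumes "finite P"
  shows "(hibi_ideal P r :: ('p hvar, 'k::field) mpoly set) [^]\<^bsub>ideals_set (hibi_ring P)\<^esub> l =
    Idl\<^bsub>mpoly_ring (hibi_vars P)\<^esub> (monom ` mult_exp P l ` antitone_maps P r l)"
proof (induction l)
  case 0
  let ?R = "mpoly_ring (hibi_vars P) :: ('p hvar, 'k) mpoly ring"
  interpret cring ?R by (rule cring_mpoly_ring)
  \<comment> \<open>The zeroth power is the whole ring: the maps bounded by 0 on \<open>P\<close>
    all give the monomial 1, and the zero map shows that there is one.\<close>
  have "mult_exp P 0 c = 0" if "c \<in> antitone_maps P r 0" for c
    using that assms by (intro hvar_poly_mapping_eqI) (auto simp: antitone_maps_def)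
  moreover have "(\<lambda>_. 0) \<in> antitone_maps P r 0" by (simp add: antitone_maps_def)
  ultimately have "mult_exp P 0 ` antitone_maps P r 0 = {0}" by force
  moreover have "(monom 0 :: ('p hvar, 'k) mpoly) = 1" by (simp add: monom_def)
  ultimately show ?case
    using genideal_one by (simp add: ideals_set_def nat_pow_def hibi_ring_def)
next
  case (Suc l)
  let ?R = "mpoly_ring (hibi_vars P) :: ('p hvar, 'k) mpoly ring"
  let ?H = "hibi_ideal P r :: ('p hvar, 'k) mpoly set"
  have H: "?H = Idl\<^bsub>?R\<^esub> (monom ` hibi_exp P ` poset_ideals P r)"
    by (simp add: hibi_ideal_def hibi_ring_def hibi_gen_monom image_image)
  have "?H [^]\<^bsub>ideals_set (hibi_ring P)\<^esub> Suc l =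
      ideal_prod ?R (?H [^]\<^bsub>ideals_set (hibi_ring P)\<^esub> l) ?H"
    by (simp add: nat_pow_def ideals_set_def hibi_ring_def)
  also have "\<dots> = ideal_prod ?R (Idl\<^bsub>?R\<^esub> (monom ` mult_exp P l ` antitone_maps P r l))
      (Idl\<^bsub>?R\<^esub> (monom ` hibi_exp P ` poset_ideals P r))"
    by (simp only: Suc.IH H[symmetric])
  also have "\<dots> = Idl\<^bsub>?R\<^esub> (monom ` {s + t | s t. s \<in> mult_exp P l ` antitone_maps P r l \<and>
      t \<in> hibi_exp P ` poset_ideals P r})"
  proof (rule ideal_prod_genideal_monom)
    show "Poly_Mapping.keys u \<subseteq> hibi_vars P" if "u \<in> mult_exp P l ` antitone_maps P r l" for u
      using that keys_mult_exp[OF assms] by blast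
    show "Poly_Mapping.keys u \<subseteq> hibi_vars P" if "u \<in> hibi_exp P ` poset_ideals P r" for u
      using that keys_hibi_exp[OF assms] unfolding poset_ideals_def by blast
  qed
  finally show ?case by (simp only: mult_exp_Suc[OF assms])
qed

lemma min_gens_hibi_power:
  fixes P :: "'p set"
  assumes "finite P"
  shows "min_gens ((hibi_ideal P r :: ('p hvar, 'k::field) mpoly set)
      [^]\<^bsub>ideals_set (hibi_ring P)\<^esub> l) = mult_exp P l ` antitone_maps P r l"
  using keys_mult_exp[OF assms] mult_exp_antichain[OF assms]
  by (intro min_gens_antichain[OF _ hibi_power_genideal[OF assms]]) blast+

section \<open>Poset ideals of the layered poset\<close>

definition layer_ideal :: "'p set \<Rightarrow> ('p \<Rightarrow> nat) \<Rightarrow> ('p \<times> nat) set"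
  where "layer_ideal P c = Sigma P (\<lambda>p. {1..c p})"

text \<open>A poset ideal \<open>J\<close> is recovered from its heights \<open>c p\<close> over the
  points \<open>p\<close>: down-closure makes each fibre an initial segment, and comparing fibres
  makes \<open>c\<close> antitone.\<close>

lemma poset_ideals_layer:
  assumes "refl_on P r"
  shows "poset_ideals (layer_set P l) (layer_order r l) = layer_ideal P ` antitone_maps P r l"
proof
  show "layer_ideal P ` antitone_maps P r l \<subseteq> poset_ideals (layer_set P l) (layer_order r l)"
    by (force simp: poset_ideals_def layer_set_def layer_order_def layer_ideal_def
        antitone_maps_def)
  show "poset_ideals (layer_set P l) (layer_order r l) \<subseteq> layer_ideal P ` antitone_maps P r l"
  proof
    fix J assume J: "J \<in> poset_ideals (layer_set P l) (layer_order r l)"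
    then have JP: "J \<subseteq> P \<times> {1..l}" by (simp add: poset_ideals_def layer_set_def)
    have down: "(p, a) \<in> J" if "(q, b) \<in> J" "p \<in> P" "(p, q) \<in> r" "1 \<le> a" "a \<le> b" for p q a b
    proof -
      have "b \<le> l" using that(1) JP by auto
      then have "(p, a) \<in> layer_set P l" "((p, a), (q, b)) \<in> layer_order r l"
        using that by (auto simp: layer_set_def layer_order_def)
      then show ?thesis using J that(1) unfolding poset_ideals_def by blast
    qed
    \<comment> \<open>The inserted 0 is the height of an empty fibre, so the maximum is attained in
      \<open>J\<close> only if it is positive.\<close>
    define c where "c p = Max (insert 0 {a. (p, a) \<in> J})" for p
    have fin: "finite (insert 0 {a. (p, a) \<in> J})" for p
      by (rule finite_subset[of _ "{..l}"]) (use JP in auto)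
    have top: "(p, c p) \<in> J" if "c p > 0" for p
      using Max_in[OF fin, of p] that unfolding c_def by auto
    have le: "a \<le> c p" if "(p, a) \<in> J" for p a
      unfolding c_def using that by (intro Max_ge fin) simp
    have "c p \<le> l" for p
      using top[of p] JP by (cases "c p > 0") auto
    moreover have "c q \<le> c p" if "p \<in> P" "(p, q) \<in> r" for p q
    proof (cases "c q > 0")
      case True
      \<comment> \<open>The point \<open>(p, c q)\<close> lies below \<open>(q, c q)\<close>, hence
        belongs to \<open>J\<close>.\<close>
      then show ?thesis using down[OF top[OF True] that, of "c q"] le by simp
    qed simp
    ultimately have "c \<in> antitone_maps P r l" by (simp add: antitone_maps_def)
    moreover have "J = layer_ideal P c"
    proof
      show "J \<subseteq> layer_ideal P c" using JP le by (auto simp: layer_ideal_def)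
      show "layer_ideal P c \<subseteq> J"
      proof
        fix x assume "x \<in> layer_ideal P c"
        then obtain p a where x: "x = (p, a)" "p \<in> P" "1 \<le> a" "a \<le> c p"
          by (auto simp: layer_ideal_def)
        \<comment> \<open>Reflexivity puts \<open>(p, a)\<close> below the top point
          \<open>(p, c p)\<close> of its own fibre.\<close>
        moreover have "(p, p) \<in> r" using assms x(2) by (rule refl_onD)
        ultimately show "x \<in> J" using down[OF top] by simp
      qed
    qed
    ultimately show "J \<in> layer_ideal P ` antitone_maps P r l" by blast
  qed
qed

text \<open>The x-indices fill the fibre \<open>{1..c p}\<close> from the bottom. Owing to the
  relabelling, the y-indices descend from \<open>l\<close> to \<open>c p + 1\<close>, which is
  exactly the complementary fibre.\<close>

lemma polarize_mult_exp:
  fixes P :: "'p set"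
  assumes "finite P" and c: "\<And>p. p \<in> P \<Longrightarrow> c p \<le> l"
  shows "polarize_monom l (mult_exp P l c) =
    (hibi_gen (layer_set P l) (layer_ideal P c) :: (('p \<times> nat) hvar, 'k::field) mpoly)"
proof -
  let ?x = "\<lambda>p j. var (VarX (p, j)) :: (('p \<times> nat) hvar, 'k) mpoly"
  let ?y = "\<lambda>p j. var (VarY (p, j)) :: (('p \<times> nat) hvar, 'k) mpoly"
  have x: "(\<Prod>p | Poly_Mapping.lookup (mult_exp P l c) (VarX p) > 0.
        \<Prod>j = 1..Poly_Mapping.lookup (mult_exp P l c) (VarX p). ?x p j) =
      (\<Prod>z\<in>layer_ideal P c. var (VarX z))"
  proof -
    \<comment> \<open>Points of \<open>P\<close> with exponent 0 contribute empty products, so the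
      outer product may run over all of \<open>P\<close>.\<close>
    have "(\<Prod>p | Poly_Mapping.lookup (mult_exp P l c) (VarX p) > 0.
        \<Prod>j = 1..Poly_Mapping.lookup (mult_exp P l c) (VarX p). ?x p j) =
        (\<Prod>p\<in>P. \<Prod>j = 1..c p. ?x p j)"
      using assms(1) by (intro prod.mono_neutral_cong_left) (auto split: if_splits intro!: gr0I)
    also have "\<dots> = (\<Prod>z\<in>layer_ideal P c. var (VarX z))"
      using assms(1) unfolding layer_ideal_def by (subst prod.Sigma) (auto intro!: prod.cong)
    finally show ?thesis .
  qed
  have compl: "layer_set P l - layer_ideal P c = Sigma P (\<lambda>p. {c p + 1..l})"
    by (auto simp: layer_set_def layer_ideal_def)
  have y: "(\<Prod>p | Poly_Mapping.lookup (mult_exp P l c) (VarY p) > 0.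
        \<Prod>j = 1..Poly_Mapping.lookup (mult_exp P l c) (VarY p). ?y p (l + 1 - j)) =
      (\<Prod>z\<in>layer_set P l - layer_ideal P c. var (VarY z))"
  proof -
    have "(\<Prod>p | Poly_Mapping.lookup (mult_exp P l c) (VarY p) > 0.
        \<Prod>j = 1..Poly_Mapping.lookup (mult_exp P l c) (VarY p). ?y p (l + 1 - j)) =
        (\<Prod>p\<in>P. \<Prod>j = 1..l - c p. ?y p (l + 1 - j))"
      using assms(1) by (intro prod.mono_neutral_cong_left) (auto split: if_splits, rule ccontr, simp)
    also have "\<dots> = (\<Prod>p\<in>P. \<Prod>j = c p + 1..l. ?y p j)"
    proof (rule prod.cong[OF refl])
      fix p assume "p \<in> P"
      then have "c p \<le> l" by (rule c)
      \<comment> \<open>The involution sending \<open>j\<close> to \<open>l + 1 - j\<close>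
        exchanges \<open>{1..l - c p}\<close> and \<open>{c p + 1..l}\<close>.\<close>
      then show "(\<Prod>j = 1..l - c p. ?y p (l + 1 - j)) = (\<Prod>j = c p + 1..l. ?y p j)"
        by (intro prod.reindex_bij_witness[of _ "\<lambda>j. l + 1 - j" "\<lambda>j. l + 1 - j"]) auto
    qed
    also have "\<dots> = (\<Prod>z\<in>layer_set P l - layer_ideal P c. var (VarY z))"
      using assms(1) unfolding compl by (subst prod.Sigma) (auto intro!: prod.cong)
    finally show ?thesis .
  qed
  show ?thesis unfolding polarize_monom_def hibi_gen_def x y ..
qed

theorem theorem4p9:
  fixes P :: "'p set" and r :: "('p \<times> 'p) set" and l :: nat
  assumes "finite P" and "partial_order_on P r" and "l \<ge> 1"
  shows "polarize_ideal P l
           ((hibi_ideal P r :: ('p hvar, 'k::field) mpoly set)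
              [^]\<^bsub>ideals_set (hibi_ring P)\<^esub> l)
         = hibi_ideal (layer_set P l) (layer_order r l)"
proof -
  let ?L = "layer_set P l"
  have "refl_on P r"
    using assms(2) by (simp add: partial_order_on_def preorder_on_def)
  note ideals = poset_ideals_layer[OF this, of l]
  \<comment> \<open>Both ideals live in the same ring, so it suffices to match their generating
    sets, each parametrized by \<open>antitone_maps P r l\<close>.\<close>
  have "(polarize_monom l (mult_exp P l c) :: (('p \<times> nat) hvar, 'k) mpoly) =
      hibi_gen ?L (layer_ideal P c)" if "c \<in> antitone_maps P r l" for c
    using that by (intro polarize_mult_exp assms(1)) (simp add: antitone_maps_def)
  then have "(polarize_monom l ` mult_exp P l ` antitone_maps P r l
      :: (('p \<times> nat) hvar, 'k) mpoly set) =
      hibi_gen ?L ` poset_ideals ?L (layer_order r l)"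
    by (simp add: ideals image_image cong: image_cong)
  then show ?thesis
    by (simp add: polarize_ideal_def hibi_ideal_def[of ?L] min_gens_hibi_power[OF assms(1)])
qed

end
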